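(* Let $C$ be a commutative Noetherian ring containing a field of characteristic zero, let $n,m\ge1$, and let $R=C[X_1,\dots,X_n,Y_1,\dots,Y_m]$ with its standard $\mathbb{Z}^2$-grading. Let $M=\bigoplus_{(u,v)\in\mathbb{Z}^2}M_{(u,v)}$ be a bigraded generalized Eulerian $A_{n,m}(C)$-module, and suppose $M_{(u_0,v_0)}\ne0$ for some $(u_0,v_0)\in\mathbb{Z}^2$. (1) If $-n<u_0<0$ and $v_0\ge0$, then $M_{(u,v)}\ne0$ for all $(u,v)\in\mathbb{Z}^2$ with $v\ge0$. (2) If $u_0\le-n$ and $-m<v_0<0$, then $M_{(u,v)}\neq0$ for all $(u,v)\in\mathbb{Z}^2$ with $u\le-n$. (3) If $-n<u_0<0$ and $v_0\le-m$, then $M_{(u,v)}\neq0$ for all $(u,v)\in\mathbb{Z}^2$ with $v\le-m$. (4) If $u_0\ge0$ and $-m<v_0<0$, then $M_{(u,v)}\neq0$ for all $(u,v)\in\mathbb{Z}^2$ with $u\ge0$. Moreover, if $-n<u_0<0$ and $-m<v_0<0$, then $M_{(u,v)}\ne0$ for all $(u,v)\in\mathbb{Z}^2$.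
   Context: $A_{n,m}(C)=R\langle \partial_1,\dots,\partial_n,\delta_1,\dots,\delta_m\rangle$ is the Weyl algebra over $C$, with $\partial_i=\partial/\partial X_i$, $\delta_j=\partial/\partial Y_j$. Both $R$ and $A_{n,m}(C)$ are $\mathbb{Z}^2$-graded by $\operatorname{bideg} c=(0,0)$ for $c\in C$, $\operatorname{bideg} X_i=(1,0)$, $\operatorname{bideg} Y_j=(0,1)$, $\operatorname{bideg}\partial_i=(-1,0)$, $\operatorname{bideg}\delta_j=(0,-1)$. Put $\mathcal{E}^X_n=\sum_{i=1}^n X_i\partial_i$ and $\mathcal{E}^Y_m=\sum_{j=1}^m Y_j\delta_j$. A bigraded (left) $A_{n,m}(C)$-module $E$ is generalized Eulerian if for each bihomogeneous $e\in E$ with $\operatorname{bideg} e=(u,v)$ there is an integer $a>0$ with $(\mathcal{E}^X_n-u)^a e=0$ and $(\mathcal{E}^Y_m-v)^a e=0$. *)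

theory Defs
  imports Complex_Main "HOL-Library.Poly_Mapping" "HOL-Library.Cardinality"
begin

definition noetherian_type :: "'c::comm_ring_1 itself \<Rightarrow> bool" where
  "noetherian_type _ \<longleftrightarrow>
     (\<forall>I :: 'c set. module.subspace (*) I \<longrightarrow> (\<exists>S. finite S \<and> I = module.span (*) S))"

definition is_subfield :: "'c::comm_ring_1 set \<Rightarrow> bool" where
  "is_subfield K \<longleftrightarrow>
     0 \<in> K \<and> 1 \<in> K \<and> (\<forall>x\<in>K. \<forall>y\<in>K. x + y \<in> K) \<and> (\<forall>x\<in>K. - x \<in> K) \<and>
     (\<forall>x\<in>K. \<forall>y\<in>K. x * y \<in> K) \<and> (\<forall>x\<in>K. x \<noteq> 0 \<longrightarrow> (\<exists>y\<in>K. x * y = 1))"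

text \<open>A subring has the same unit as the ambient ring, so the characteristic of a subfield is
  read off in the ambient ring.\<close>

definition contains_field_char_0 :: "'c::comm_ring_1 itself \<Rightarrow> bool" where
  "contains_field_char_0 _ \<longleftrightarrow>
     (\<exists>K :: 'c set. is_subfield K \<and> (\<forall>k::nat. k > 0 \<longrightarrow> (of_nat k :: 'c) \<noteq> 0))"

text \<open>The polynomial ring $R = C[X_i, Y_j]$, with $i$ and $j$ ranging over the finite types
  \<open>'n\<close> and \<open>'m\<close>: the monoid algebra of the exponent vectors, where the index \<open>Inl i\<close>
  stands for $X_i$ and \<open>Inr j\<close> for $Y_j$.\<close>

type_synonym ('c, 'n, 'm) bipoly = "('n + 'm \<Rightarrow>\<^sub>0 nat) \<Rightarrow>\<^sub>0 'c"

definition poly_const :: "'c::comm_ring_1 \<Rightarrow> ('c, 'n, 'm) bipoly" where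
  "poly_const c = Poly_Mapping.single 0 c"

definition poly_var :: "'n + 'm \<Rightarrow> ('c::comm_ring_1, 'n, 'm) bipoly" where
  "poly_var k = Poly_Mapping.single (Poly_Mapping.single k 1) 1"

text \<open>On monomials, $c Z^t \mapsto t_k c Z^{t - e_k}$. The subtraction of exponents is truncated,
  but where it matters the coefficient $t_k$ is $0$.\<close>

definition partial_deriv ::
  "'n + 'm \<Rightarrow> ('c::comm_ring_1, 'n, 'm) bipoly \<Rightarrow> ('c, 'n, 'm) bipoly" where
  "partial_deriv k p =
     (\<Sum>t\<in>Poly_Mapping.keys p.
        Poly_Mapping.single (t - Poly_Mapping.single k 1)
          (of_nat (Poly_Mapping.lookup t k) * Poly_Mapping.lookup p t))"

lemma lookup_partial_deriv:
  "Poly_Mapping.lookup (partial_deriv k p) t =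
     of_nat (Poly_Mapping.lookup t k + 1) * Poly_Mapping.lookup p (t + Poly_Mapping.single k 1)"
proof -
  let ?e = "Poly_Mapping.single k (1::nat)"
  have eq: "(of_nat (Poly_Mapping.lookup s k) * Poly_Mapping.lookup p s when s - ?e = t) =
      (of_nat (Poly_Mapping.lookup s k) * Poly_Mapping.lookup p s when s = t + ?e)" for s
  proof (cases "Poly_Mapping.lookup s k = 0")
    case False
    have "s - ?e + ?e = s"
    proof (rule poly_mapping_eqI)
      fix i
      show "Poly_Mapping.lookup (s - ?e + ?e) i = Poly_Mapping.lookup s i"
        using False by (cases "i = k") (auto simp: lookup_add lookup_minus lookup_single)
    qed
    then have "s - ?e = t \<longleftrightarrow> s = t + ?e" by auto
    then show ?thesis by simp
  qed simp
  have "Poly_Mapping.lookup (partial_deriv k p) t =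
      (\<Sum>s\<in>Poly_Mapping.keys p.
        of_nat (Poly_Mapping.lookup s k) * Poly_Mapping.lookup p s when s = t + ?e)"
    unfolding partial_deriv_def lookup_sum lookup_single eq ..
  also have "\<dots> = of_nat (Poly_Mapping.lookup t k + 1) * Poly_Mapping.lookup p (t + ?e)"
    by (auto simp: when_def lookup_add lookup_single in_keys_iff sum.delta)
  finally show ?thesis .
qed

lemma partial_deriv_add: "partial_deriv k (p + q) = partial_deriv k p + partial_deriv k q"
  by (rule poly_mapping_eqI) (simp add: lookup_partial_deriv lookup_add distrib_left)

text \<open>The Weyl algebra $A_{n,m}(C) = R\langle\partial_i, \delta_j\rangle$ is the subring of the
  endomorphisms of $R$ generated by the multiplications with elements of $R$ and by the partial
  derivatives.\<close>

inductive_set weyl_ops ::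
  "(('c::comm_ring_1, 'n, 'm) bipoly \<Rightarrow> ('c, 'n, 'm) bipoly) set" where
  weyl_ops_mult: "(\<lambda>p. f * p) \<in> weyl_ops"
| weyl_ops_deriv: "partial_deriv k \<in> weyl_ops"
| weyl_ops_add: "D \<in> weyl_ops \<Longrightarrow> E \<in> weyl_ops \<Longrightarrow> (\<lambda>p. D p + E p) \<in> weyl_ops"
| weyl_ops_uminus: "D \<in> weyl_ops \<Longrightarrow> (\<lambda>p. - D p) \<in> weyl_ops"
| weyl_ops_comp: "D \<in> weyl_ops \<Longrightarrow> E \<in> weyl_ops \<Longrightarrow> (\<lambda>p. D (E p)) \<in> weyl_ops"

lemma weyl_ops_zero: "(\<lambda>p. 0) \<in> weyl_ops"
proof -
  have "(\<lambda>p. 0 * p) \<in> weyl_ops" by (rule weyl_ops_mult)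
  then show ?thesis by (simp only: mult_zero_left)
qed

lemma weyl_ops_one: "(\<lambda>p. p) \<in> weyl_ops"
proof -
  have "(\<lambda>p. 1 * p) \<in> weyl_ops" by (rule weyl_ops_mult)
  then show ?thesis by (simp only: mult_1_left)
qed

lemma weyl_ops_additive: "D \<in> weyl_ops \<Longrightarrow> D (p + q) = D p + D q"
  by (induction arbitrary: p q rule: weyl_ops.induct)
    (simp_all add: distrib_left partial_deriv_add)

typedef (overloaded) ('c::comm_ring_1, 'n, 'm) weyl =
  "weyl_ops :: (('c, 'n, 'm) bipoly \<Rightarrow> ('c, 'n, 'm) bipoly) set"
  morphisms weyl_apply Abs_weyl
  using weyl_ops_zero by blast

lifting_forget poly_mapping.lifting
setup_lifting type_definition_weyl

instantiation weyl :: (comm_ring_1, type, type) ring_1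
begin

lift_definition zero_weyl :: "('a, 'b, 'c) weyl" is "\<lambda>p. 0" by (rule weyl_ops_zero)
lift_definition one_weyl :: "('a, 'b, 'c) weyl" is "\<lambda>p. p" by (rule weyl_ops_one)
lift_definition plus_weyl :: "('a, 'b, 'c) weyl \<Rightarrow> ('a, 'b, 'c) weyl \<Rightarrow> ('a, 'b, 'c) weyl"
  is "\<lambda>D E p. D p + E p" by (rule weyl_ops_add)
lift_definition uminus_weyl :: "('a, 'b, 'c) weyl \<Rightarrow> ('a, 'b, 'c) weyl"
  is "\<lambda>D p. - D p" by (rule weyl_ops_uminus)
lift_definition times_weyl :: "('a, 'b, 'c) weyl \<Rightarrow> ('a, 'b, 'c) weyl \<Rightarrow> ('a, 'b, 'c) weyl"
  is "\<lambda>D E p. D (E p)" by (rule weyl_ops_comp)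
definition minus_weyl :: "('a, 'b, 'c) weyl \<Rightarrow> ('a, 'b, 'c) weyl \<Rightarrow> ('a, 'b, 'c) weyl"
  where "minus_weyl D E = D + - E"

instance
proof
  fix a b c :: "('a, 'b, 'c) weyl"
  show "a * b * c = a * (b * c)" by transfer simp
  show "1 * a = a" by transfer simp
  show "a * 1 = a" by transfer simp
  show "a + b + c = a + (b + c)" by transfer (simp add: add.assoc)
  show "a + b = b + a" by transfer (simp add: add.commute)
  show "0 + a = a" by transfer simp
  show "- a + a = 0" by transfer simp
  show "a - b = a + - b" by (rule minus_weyl_def)
  show "(a + b) * c = a * c + b * c" by transfer simp
  show "a * (b + c) = a * b + a * c" by transfer (simp add: weyl_ops_additive)
  show "(0 :: ('a, 'b, 'c) weyl) \<noteq> 1" by transfer (metis zero_neq_one)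
qed

end

lift_definition weyl_poly :: "('c::comm_ring_1, 'n, 'm) bipoly \<Rightarrow> ('c, 'n, 'm) weyl"
  is "\<lambda>f p. f * p" by (rule weyl_ops_mult)

lift_definition weyl_deriv :: "'n + 'm \<Rightarrow> ('c::comm_ring_1, 'n, 'm) weyl"
  is partial_deriv by (rule weyl_ops_deriv)

abbreviation weyl_X :: "'n \<Rightarrow> ('c::comm_ring_1, 'n, 'm) weyl" where
  "weyl_X i \<equiv> weyl_poly (poly_var (Inl i))"

abbreviation weyl_Y :: "'m \<Rightarrow> ('c::comm_ring_1, 'n, 'm) weyl" where
  "weyl_Y j \<equiv> weyl_poly (poly_var (Inr j))"

abbreviation weyl_dX :: "'n \<Rightarrow> ('c::comm_ring_1, 'n, 'm) weyl" where
  "weyl_dX i \<equiv> weyl_deriv (Inl i)"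

abbreviation weyl_dY :: "'m \<Rightarrow> ('c::comm_ring_1, 'n, 'm) weyl" where
  "weyl_dY j \<equiv> weyl_deriv (Inr j)"

definition euler_X :: "('c::comm_ring_1, 'n::finite, 'm) weyl" where
  "euler_X = (\<Sum>i\<in>UNIV. weyl_X i * weyl_dX i)"

definition euler_Y :: "('c::comm_ring_1, 'n, 'm::finite) weyl" where
  "euler_Y = (\<Sum>j\<in>UNIV. weyl_Y j * weyl_dY j)"

text \<open>\<open>weyl_bihom a b D\<close>: the operator \<open>D\<close> lies in the component of bidegree $(a,b)$ of the
  grading determined by the bidegrees of the generators, i.e. it is a sum of products of
  generators of total bidegree $(a,b)$.\<close>

inductive weyl_bihom :: "int \<Rightarrow> int \<Rightarrow> ('c::comm_ring_1, 'n, 'm) weyl \<Rightarrow> bool" where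
  weyl_bihom_const: "weyl_bihom 0 0 (weyl_poly (poly_const c))"
| weyl_bihom_X: "weyl_bihom 1 0 (weyl_X i)"
| weyl_bihom_Y: "weyl_bihom 0 1 (weyl_Y j)"
| weyl_bihom_dX: "weyl_bihom (-1) 0 (weyl_dX i)"
| weyl_bihom_dY: "weyl_bihom 0 (-1) (weyl_dY j)"
| weyl_bihom_zero: "weyl_bihom a b 0"
| weyl_bihom_add: "weyl_bihom a b D \<Longrightarrow> weyl_bihom a b E \<Longrightarrow> weyl_bihom a b (D + E)"
| weyl_bihom_mult:
    "weyl_bihom a b D \<Longrightarrow> weyl_bihom a' b' E \<Longrightarrow> weyl_bihom (a + a') (b + b') (D * E)"

text \<open>The library locale \<open>module\<close> only covers commutative rings of scalars.\<close>

locale left_module =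
  fixes act :: "'a::ring_1 \<Rightarrow> 'e::ab_group_add \<Rightarrow> 'e"  (infixr \<open>\<cdot>\<close> 75)
  assumes act_add_right: "a \<cdot> (x + y) = a \<cdot> x + a \<cdot> y"
    and act_add_left: "(a + b) \<cdot> x = a \<cdot> x + b \<cdot> x"
    and act_mult: "(a * b) \<cdot> x = a \<cdot> b \<cdot> x"
    and act_one: "1 \<cdot> x = x"

definition additive_subgroup :: "'e::ab_group_add set \<Rightarrow> bool" where
  "additive_subgroup S \<longleftrightarrow> 0 \<in> S \<and> (\<forall>x\<in>S. \<forall>y\<in>S. x + y \<in> S) \<and> (\<forall>x\<in>S. - x \<in> S)"

text \<open>The whole group is the internal direct sum of the family \<open>M\<close> of subgroups: every element
  has a unique decomposition into finitely many nonzero components.\<close>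

definition internal_direct_sum :: "('i \<Rightarrow> 'e::ab_group_add set) \<Rightarrow> bool" where
  "internal_direct_sum M \<longleftrightarrow>
     (\<forall>d. additive_subgroup (M d)) \<and>
     (\<forall>x. \<exists>!f. (\<forall>d. f d \<in> M d) \<and> finite {d. f d \<noteq> 0} \<and> x = (\<Sum>d | f d \<noteq> 0. f d))"

locale bigraded_weyl_module = left_module act
  for act :: "('c::comm_ring_1, 'n::finite, 'm::finite) weyl \<Rightarrow> 'e::ab_group_add \<Rightarrow> 'e" +
  fixes M :: "int \<times> int \<Rightarrow> 'e set"
  assumes direct_sum: "internal_direct_sum M"
    and act_bihom: "weyl_bihom a b D \<Longrightarrow> x \<in> M (u, v) \<Longrightarrow> act D x \<in> M (a + u, b + v)"

definition generalized_eulerian ::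
  "(('c::comm_ring_1, 'n::finite, 'm::finite) weyl \<Rightarrow> 'e::ab_group_add \<Rightarrow> 'e)
     \<Rightarrow> (int \<times> int \<Rightarrow> 'e set) \<Rightarrow> bool" where
  "generalized_eulerian act M \<longleftrightarrow>
     (\<forall>u v. \<forall>e\<in>M (u, v). \<exists>a::nat. a > 0 \<and>
        act ((euler_X - of_int u) ^ a) e = 0 \<and> act ((euler_Y - of_int v) ^ a) e = 0)"

end

theory Submission
  imports Defs
begin

text \<open>Let \<open>e\<close> be a nonzero element of \<open>M (u, v)\<close>. If every \<open>X\<^sub>i\<close> kills \<open>e\<close>, then the sum of the
  \<open>\<partial>\<^sub>i X\<^sub>i = X\<^sub>i \<partial>\<^sub>i + 1\<close> kills \<open>e\<close>, so \<open>e\<close> is an eigenvector of the Euler operator with eigenvalue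
  \<open>-n\<close>; a power of the Euler operator minus \<open>u\<close> kills \<open>e\<close> and nonzero integers act injectively,
  hence \<open>u = -n\<close>. If every \<open>\<partial>\<^sub>i\<close> kills \<open>e\<close>, the eigenvalue is \<open>0\<close> and \<open>u = 0\<close>. So nonvanishing
  passes from \<open>u\<close> to \<open>u + 1\<close> unless \<open>u = -n\<close>, and from \<open>u\<close> to \<open>u - 1\<close> unless \<open>u = 0\<close>; likewise
  for \<open>v\<close>.\<close>

section \<open>The commutation relation between a variable and its derivative\<close>

lemma partial_deriv_single:
  "partial_deriv k (Poly_Mapping.single t c) =
     Poly_Mapping.single (t - Poly_Mapping.single k 1) (of_nat (Poly_Mapping.lookup t k) * c)"
  by (cases "c = 0") (simp_all add: partial_deriv_def)

text \<open>By additivity it is enough to treat a monomial, where the coefficient t_k + 1 produced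
  by differentiating after the multiplication splits into t_k and 1.\<close>

lemma partial_deriv_poly_var_mult:
  "partial_deriv k (poly_var k * p) = poly_var k * partial_deriv k p + p"
proof (induction p rule: Poly_Mapping.update_induct)
  case const
  then show ?case
    by (simp add: partial_deriv_def)
next
  case (update p t c)
  let ?e = "Poly_Mapping.single k (1::nat)"
  let ?s = "Poly_Mapping.single t c"
  have single: "partial_deriv k (poly_var k * ?s) = poly_var k * partial_deriv k ?s + ?s"
  \<comment> \<open>Truncated subtraction makes \<open>?e + (t - ?e) = t\<close> fail when t_k = 0,
    but then the coefficient t_k removes the derivative term.\<close>
  proof (cases "Poly_Mapping.lookup t k = 0")
    case True
    then show ?thesis
      by (simp add: poly_var_def mult_single partial_deriv_single lookup_add)
  next
    case False
    have "?e + (t - ?e) = t"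
      using False by (intro poly_mapping_eqI) (auto simp: lookup_add lookup_minus lookup_single when_def)
    then show ?thesis
      by (simp add: poly_var_def mult_single partial_deriv_single lookup_add distrib_right
          single_add[symmetric] add.commute)
  qed
  have "Poly_Mapping.update t c p = ?s + p"
    using update.hyps
    by (intro poly_mapping_eqI) (auto simp: lookup_update lookup_add lookup_single in_keys_iff)
  then show ?case
    by (simp add: distrib_left partial_deriv_add single update.IH)
qed

lemma weyl_deriv_mult_var:
  "weyl_deriv k * weyl_poly (poly_var k) = weyl_poly (poly_var k) * weyl_deriv k + 1"
  by transfer (simp add: partial_deriv_poly_var_mult)

section \<open>Nonzero integers are invertible in the Weyl algebra\<close>

lemma weyl_poly_const_one: "weyl_poly (poly_const 1) = 1"
  by transfer (simp add: poly_const_def)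

lemma weyl_poly_const_add:
  "weyl_poly (poly_const (a + b)) = weyl_poly (poly_const a) + weyl_poly (poly_const b)"
  by transfer (simp add: fun_eq_iff poly_const_def single_add distrib_right)

lemma weyl_poly_const_mult:
  "weyl_poly (poly_const (a * b)) = weyl_poly (poly_const a) * weyl_poly (poly_const b)"
  by transfer (simp add: poly_const_def mult.assoc[symmetric] mult_single)

lemma weyl_poly_const_of_nat: "weyl_poly (poly_const (of_nat k)) = of_nat k"
proof (induction k)
  case 0
  then show ?case by (simp, transfer) (simp add: poly_const_def)
qed (simp add: weyl_poly_const_add weyl_poly_const_one)

lemma is_subfield_of_nat: "is_subfield K \<Longrightarrow> of_nat k \<in> K"
  by (induction k) (auto simp: is_subfield_def)

text \<open>The absolute value of k is a nonzero element of the subfield, so it has an inverse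
  there; the constant polynomial with that value, up to sign, inverts k. A left inverse is what
  makes k act injectively on a module.\<close>

lemma weyl_of_int_left_inverse:
  assumes "contains_field_char_0 TYPE('c::comm_ring_1)" and "k \<noteq> 0"
  shows "\<exists>c :: ('c, 'n, 'm) weyl. c * of_int k = 1"
proof -
  obtain K :: "'c set" where K: "is_subfield K" and char: "\<And>k::nat. k > 0 \<Longrightarrow> (of_nat k :: 'c) \<noteq> 0"
    using assms(1) unfolding contains_field_char_0_def by blast
  define j where "j = nat \<bar>k\<bar>"
  have "j > 0" using assms(2) by (simp add: j_def)
  then obtain y :: 'c where "of_nat j * y = 1"
    using char[of j] is_subfield_of_nat[OF K, of j] K unfolding is_subfield_def by blast
  then have inv: "weyl_poly (poly_const y) * of_nat j = (1 :: ('c, 'n, 'm) weyl)"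
    by (metis weyl_poly_const_mult weyl_poly_const_of_nat weyl_poly_const_one mult.commute)
  have "k = int j \<or> k = - int j" by (auto simp: j_def)
  then show ?thesis
  proof
    assume "k = int j"
    then show ?thesis using inv by auto
  next
    assume "k = - int j"
    then have "- weyl_poly (poly_const y) * of_int k = (1 :: ('c, 'n, 'm) weyl)"
      using inv by simp
    then show ?thesis by blast
  qed
qed

section \<open>Generalized eigenvalues of Euler operators\<close>

context left_module
begin

lemma act_zero_left [simp]: "0 \<cdot> x = 0"
  using act_add_left[of 0 0 x] by simp

lemma act_zero_right [simp]: "a \<cdot> 0 = 0"
  using act_add_right[of a 0 0] by simp

lemma act_sum_left: "(\<Sum>i\<in>S. f i) \<cdot> x = (\<Sum>i\<in>S. f i \<cdot> x)"
  by (induction S rule: infinite_finite_induct) (simp_all add: act_add_left)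

lemma act_diff_left: "(a - b) \<cdot> x = a \<cdot> x - b \<cdot> x"
  using act_add_left[of "a - b" b x] by (simp add: algebra_simps)

text \<open>Integers are central, so T - u acts on integer multiples of e as k - u. Hence (k - u)^a
  kills e, and if u and k differed, this power would have a left inverse, forcing e = 0.\<close>

lemma generalized_eigenvalue_unique:
  assumes int_inv: "\<And>k. k \<noteq> 0 \<Longrightarrow> \<exists>c :: 'a. c * of_int k = 1"
    and eigen: "T \<cdot> e = of_int k \<cdot> e"
    and gen: "(T - of_int u) ^ a \<cdot> e = 0"
    and "e \<noteq> 0"
  shows "u = k"
proof (rule ccontr)
  assume "u \<noteq> k"
  have pow: "(T - of_int u) ^ b \<cdot> e = of_int ((k - u) ^ b) \<cdot> e" for b
  proof (induction b)
    case (Suc b)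
    have "(T - of_int u) ^ Suc b \<cdot> e = (T - of_int u) \<cdot> of_int ((k - u) ^ b) \<cdot> e"
      by (simp only: power_Suc act_mult Suc.IH)
    also have "\<dots> = of_int ((k - u) ^ b) \<cdot> (T - of_int u) \<cdot> e"
      unfolding act_mult[symmetric]
      by (simp only: mult_of_int_commute)
    also have "(T - of_int u) \<cdot> e = of_int (k - u) \<cdot> e"
      by (simp add: act_diff_left eigen)
    also have "of_int ((k - u) ^ b) \<cdot> \<dots> = of_int ((k - u) ^ Suc b) \<cdot> e"
      by (simp only: act_mult[symmetric] of_int_mult[symmetric] power_Suc2)
    finally show ?case .
  qed simp
  obtain c :: 'a where "c * of_int ((k - u) ^ a) = 1"
    using int_inv[of "(k - u) ^ a"] \<open>u \<noteq> k\<close> by auto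
  then have "e = c \<cdot> of_int ((k - u) ^ a) \<cdot> e"
    by (metis act_mult act_one)
  also have "\<dots> = 0" using gen by (simp only: pow act_zero_right)
  finally show False using \<open>e \<noteq> 0\<close> by simp
qed

text \<open>Stated for arbitrary finite families in the ring, so that it serves both the X and the Y
  variables.\<close>

lemma euler_degree_killed_by_derivs:
  fixes x d :: "'k::finite \<Rightarrow> 'a"
  assumes "\<And>k. k \<noteq> 0 \<Longrightarrow> \<exists>c :: 'a. c * of_int k = 1"
    and "((\<Sum>i\<in>UNIV. x i * d i) - of_int u) ^ a \<cdot> e = 0"
    and "e \<noteq> 0"
    and "\<And>i. d i \<cdot> e = 0"
  shows "u = 0"
proof (rule generalized_eigenvalue_unique[OF assms(1) _ assms(2,3)])
  show "(\<Sum>i\<in>UNIV. x i * d i) \<cdot> e = of_int 0 \<cdot> e"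
    by (simp add: act_sum_left act_mult assms(4))
qed

text \<open>The commutation relation moves each x_i to the right, next to e, at the cost of -1 per
  index; only these constants survive.\<close>

lemma euler_degree_killed_by_vars:
  fixes x d :: "'k::finite \<Rightarrow> 'a"
  assumes "\<And>k. k \<noteq> 0 \<Longrightarrow> \<exists>c :: 'a. c * of_int k = 1"
    and "((\<Sum>i\<in>UNIV. x i * d i) - of_int u) ^ a \<cdot> e = 0"
    and "e \<noteq> 0"
    and "\<And>i. d i * x i = x i * d i + 1"
    and "\<And>i. x i \<cdot> e = 0"
  shows "u = - int CARD('k)"
proof (rule generalized_eigenvalue_unique[OF assms(1) _ assms(2,3)])
  have "(\<Sum>i\<in>UNIV. x i * d i) = (\<Sum>i\<in>UNIV. d i * x i) - of_nat CARD('k)"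
    by (simp add: assms(4) sum.distrib)
  \<comment> \<open>The instance of \<open>act_diff_left\<close> at 0 shows that a negated scalar
    acts as the negative.\<close>
  then show "(\<Sum>i\<in>UNIV. x i * d i) \<cdot> e = of_int (- int CARD('k)) \<cdot> e"
    using act_diff_left[of 0 "of_nat CARD('k)" e]
    by (simp add: act_diff_left act_sum_left act_mult assms(5))
qed

end

section \<open>Propagation of nonvanishing along rows and columns\<close>

lemma int_steps_propagate:
  fixes P :: "int \<Rightarrow> bool"
  assumes up: "\<And>u. P u \<Longrightarrow> u \<noteq> - n \<Longrightarrow> P (u + 1)"
    and down: "\<And>u. P u \<Longrightarrow> u \<noteq> 0 \<Longrightarrow> P (u - 1)"
    and "P u\<^sub>0" and "n > 0"
  shows "- n < u\<^sub>0 \<Longrightarrow> u\<^sub>0 < 0 \<Longrightarrow> P u"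
    and "u\<^sub>0 \<ge> 0 \<Longrightarrow> u \<ge> 0 \<Longrightarrow> P u"
    and "u\<^sub>0 \<le> - n \<Longrightarrow> u \<le> - n \<Longrightarrow> P u"
proof -
  \<comment> \<open>The climb uses \<open>up\<close> at the integers from \<open>u\<^sub>0\<close>
    to w - 1; the second condition keeps the barrier -n out of this range.\<close>
  have above: "P w" if "u\<^sub>0 \<le> w" "- n < u\<^sub>0 \<or> w \<le> - n" for w
    using that
  proof (induction w rule: int_ge_induct)
    case (step w)
    then show ?case using up[of w] by auto
  qed (use \<open>P u\<^sub>0\<close> in simp)
  \<comment> \<open>The descent uses \<open>down\<close> from \<open>u\<^sub>0\<close> to w + 1, a
    range that must avoid 0.\<close>
  have below: "P w" if "w \<le> u\<^sub>0" "u\<^sub>0 < 0 \<or> 0 \<le> w" for w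
    using that
  proof (induction w rule: int_le_induct)
    case (step w)
    then show ?case using down[of w] by auto
  qed (use \<open>P u\<^sub>0\<close> in simp)
  show "P u" if "- n < u\<^sub>0" "u\<^sub>0 < 0"
    using above[of u] below[of u] that by linarith
  \<comment> \<open>Here and in the next case, -n < 0 gives unrestricted movement away from the
    strip between the barriers.\<close>
  show "P u" if "u\<^sub>0 \<ge> 0" "u \<ge> 0"
    using above[of u] below[of u] that \<open>n > 0\<close> by linarith
  show "P u" if "u\<^sub>0 \<le> - n" "u \<le> - n"
    using above[of u] below[of u] that \<open>n > 0\<close> by linarith
qed

context bigraded_weyl_module
begin

text \<open>Components are subgroups, so differing from {0} cannot mean being empty.\<close>

lemma component_nonzero_iff: "M w \<noteq> {0} \<longleftrightarrow> (\<exists>e\<in>M w. e \<noteq> 0)"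
  using direct_sum unfolding internal_direct_sum_def additive_subgroup_def by blast

context
  assumes char: "contains_field_char_0 TYPE('c)"
    and eulerian: "generalized_eulerian act M"
begin

lemma int_inverse: "k \<noteq> 0 \<Longrightarrow> \<exists>c :: ('c, 'n, 'm) weyl. c * of_int k = 1"
  using weyl_of_int_left_inverse[OF char] by blast

text \<open>Spells out the Euler operators as sums, the form in which the eigenvalue lemmas for
  families apply.\<close>

lemma eulerian_nilpotent:
  assumes "e \<in> M (u, v)"
  obtains a where "act (((\<Sum>i\<in>UNIV. weyl_X i * weyl_dX i) - of_int u) ^ a) e = 0"
    and "act (((\<Sum>j\<in>UNIV. weyl_Y j * weyl_dY j) - of_int v) ^ a) e = 0"
  using eulerian assms unfolding generalized_eulerian_def euler_X_def euler_Y_def by blast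

lemma X_step_up:
  assumes "M (u, v) \<noteq> {0}" and "u \<noteq> - int CARD('n)"
  shows "M (u + 1, v) \<noteq> {0}"
proof -
  obtain e where e: "e \<in> M (u, v)" "e \<noteq> 0" using assms(1) component_nonzero_iff by blast
  obtain a where "act (((\<Sum>i\<in>UNIV. weyl_X i * weyl_dX i) - of_int u) ^ a) e = 0"
    using e(1) by (rule eulerian_nilpotent)
  \<comment> \<open>If every variable killed e, the degree u would be -n; so some variable moves e
    to a nonzero element.\<close>
  from euler_degree_killed_by_vars[OF int_inverse this e(2) weyl_deriv_mult_var] assms(2)
  obtain i where "act (weyl_X i) e \<noteq> 0" by blast
  moreover have "act (weyl_X i) e \<in> M (u + 1, v)"
    using act_bihom[OF weyl_bihom_X e(1), of i] by (simp add: add.commute)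
  ultimately show ?thesis using component_nonzero_iff by blast
qed

lemma X_step_down:
  assumes "M (u, v) \<noteq> {0}" and "u \<noteq> 0"
  shows "M (u - 1, v) \<noteq> {0}"
proof -
  obtain e where e: "e \<in> M (u, v)" "e \<noteq> 0" using assms(1) component_nonzero_iff by blast
  obtain a where "act (((\<Sum>i\<in>UNIV. weyl_X i * weyl_dX i) - of_int u) ^ a) e = 0"
    using e(1) by (rule eulerian_nilpotent)
  from euler_degree_killed_by_derivs[OF int_inverse this e(2)] assms(2)
  obtain i where "act (weyl_dX i) e \<noteq> 0" by blast
  moreover have "act (weyl_dX i) e \<in> M (u - 1, v)"
    using act_bihom[OF weyl_bihom_dX e(1), of i] by simp
  ultimately show ?thesis using component_nonzero_iff by blast
qed

lemma Y_step_up: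
  assumes "M (u, v) \<noteq> {0}" and "v \<noteq> - int CARD('m)"
  shows "M (u, v + 1) \<noteq> {0}"
proof -
  obtain e where e: "e \<in> M (u, v)" "e \<noteq> 0" using assms(1) component_nonzero_iff by blast
  obtain a where "act (((\<Sum>j\<in>UNIV. weyl_Y j * weyl_dY j) - of_int v) ^ a) e = 0"
    using e(1) by (rule eulerian_nilpotent)
  from euler_degree_killed_by_vars[OF int_inverse this e(2) weyl_deriv_mult_var] assms(2)
  obtain j where "act (weyl_Y j) e \<noteq> 0" by blast
  moreover have "act (weyl_Y j) e \<in> M (u, v + 1)"
    using act_bihom[OF weyl_bihom_Y e(1), of j] by (simp add: add.commute)
  ultimately show ?thesis using component_nonzero_iff by blast
qed

lemma Y_step_down:
  assumes "M (u, v) \<noteq> {0}" and "v \<noteq> 0"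
  shows "M (u, v - 1) \<noteq> {0}"
proof -
  obtain e where e: "e \<in> M (u, v)" "e \<noteq> 0" using assms(1) component_nonzero_iff by blast
  obtain a where "act (((\<Sum>j\<in>UNIV. weyl_Y j * weyl_dY j) - of_int v) ^ a) e = 0"
    using e(1) by (rule eulerian_nilpotent)
  from euler_degree_killed_by_derivs[OF int_inverse this e(2)] assms(2)
  obtain j where "act (weyl_dY j) e \<noteq> 0" by blast
  moreover have "act (weyl_dY j) e \<in> M (u, v - 1)"
    using act_bihom[OF weyl_bihom_dY e(1), of j] by simp
  ultimately show ?thesis using component_nonzero_iff by blast
qed

lemma X_propagate:
  assumes "M (u\<^sub>0, v) \<noteq> {0}"
  shows "- int CARD('n) < u\<^sub>0 \<Longrightarrow> u\<^sub>0 < 0 \<Longrightarrow> M (u, v) \<noteq> {0}"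
    and "u\<^sub>0 \<ge> 0 \<Longrightarrow> u \<ge> 0 \<Longrightarrow> M (u, v) \<noteq> {0}"
    and "u\<^sub>0 \<le> - int CARD('n) \<Longrightarrow> u \<le> - int CARD('n) \<Longrightarrow> M (u, v) \<noteq> {0}"
  using int_steps_propagate[where P = "\<lambda>u. M (u, v) \<noteq> {0}", OF X_step_up X_step_down assms]
  by simp_all

lemma Y_propagate:
  assumes "M (u, v\<^sub>0) \<noteq> {0}"
  shows "- int CARD('m) < v\<^sub>0 \<Longrightarrow> v\<^sub>0 < 0 \<Longrightarrow> M (u, v) \<noteq> {0}"
    and "v\<^sub>0 \<ge> 0 \<Longrightarrow> v \<ge> 0 \<Longrightarrow> M (u, v) \<noteq> {0}"
    and "v\<^sub>0 \<le> - int CARD('m) \<Longrightarrow> v \<le> - int CARD('m) \<Longrightarrow> M (u, v) \<noteq> {0}"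
  using int_steps_propagate[where P = "\<lambda>v. M (u, v) \<noteq> {0}", OF Y_step_up Y_step_down assms]
  by simp_all

end

end

theorem theorem5p9:
  fixes act :: "('c::comm_ring_1, 'n::finite, 'm::finite) weyl \<Rightarrow> 'e::ab_group_add \<Rightarrow> 'e"
    and M :: "int \<times> int \<Rightarrow> 'e set"
    and u\<^sub>0 v\<^sub>0 :: int
  assumes "noetherian_type TYPE('c)"
    and "contains_field_char_0 TYPE('c)"
    and "bigraded_weyl_module act M"
    and "generalized_eulerian act M"
    and "M (u\<^sub>0, v\<^sub>0) \<noteq> {0}"
  shows "(- int CARD('n) < u\<^sub>0 \<and> u\<^sub>0 < 0 \<and> v\<^sub>0 \<ge> 0
            \<longrightarrow> (\<forall>u v. v \<ge> 0 \<longrightarrow> M (u, v) \<noteq> {0})) \<and>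
         (u\<^sub>0 \<le> - int CARD('n) \<and> - int CARD('m) < v\<^sub>0 \<and> v\<^sub>0 < 0
            \<longrightarrow> (\<forall>u v. u \<le> - int CARD('n) \<longrightarrow> M (u, v) \<noteq> {0})) \<and>
         (- int CARD('n) < u\<^sub>0 \<and> u\<^sub>0 < 0 \<and> v\<^sub>0 \<le> - int CARD('m)
            \<longrightarrow> (\<forall>u v. v \<le> - int CARD('m) \<longrightarrow> M (u, v) \<noteq> {0})) \<and>
         (u\<^sub>0 \<ge> 0 \<and> - int CARD('m) < v\<^sub>0 \<and> v\<^sub>0 < 0
            \<longrightarrow> (\<forall>u v. u \<ge> 0 \<longrightarrow> M (u, v) \<noteq> {0})) \<and>
         (- int CARD('n) < u\<^sub>0 \<and> u\<^sub>0 < 0 \<and> - int CARD('m) < v\<^sub>0 \<and> v\<^sub>0 < 0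
            \<longrightarrow> (\<forall>u v. M (u, v) \<noteq> {0}))"
proof -
  interpret bigraded_weyl_module act M by fact
  note X = X_propagate[OF assms(2,4)] and Y = Y_propagate[OF assms(2,4)]
  show ?thesis
  proof (intro conjI impI allI; elim conjE)
    fix u v :: int
    \<comment> \<open>Every case first moves along the row \<open>v\<^sub>0\<close> from
      \<open>u\<^sub>0\<close> to u, then along the column u from \<open>v\<^sub>0\<close> to
      v.\<close>
    show "M (u, v) \<noteq> {0}" if "- int CARD('n) < u\<^sub>0" "u\<^sub>0 < 0" "v\<^sub>0 \<ge> 0" "v \<ge> 0"
      using Y(2)[OF X(1)[OF assms(5)]] that by simp
    show "M (u, v) \<noteq> {0}" if "u\<^sub>0 \<le> - int CARD('n)" "- int CARD('m) < v\<^sub>0" "v\<^sub>0 < 0"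
      "u \<le> - int CARD('n)"
      using Y(1)[OF X(3)[OF assms(5)]] that by simp
    show "M (u, v) \<noteq> {0}" if "- int CARD('n) < u\<^sub>0" "u\<^sub>0 < 0" "v\<^sub>0 \<le> - int CARD('m)"
      "v \<le> - int CARD('m)"
      using Y(3)[OF X(1)[OF assms(5)]] that by simp
    show "M (u, v) \<noteq> {0}" if "u\<^sub>0 \<ge> 0" "- int CARD('m) < v\<^sub>0" "v\<^sub>0 < 0" "u \<ge> 0"
      using Y(1)[OF X(2)[OF assms(5)]] that by simp
    show "M (u, v) \<noteq> {0}" if "- int CARD('n) < u\<^sub>0" "u\<^sub>0 < 0" "- int CARD('m) < v\<^sub>0" "v\<^sub>0 < 0"
      using Y(1)[OF X(1)[OF assms(5)]] that by simp
  qed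
qed

end
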